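(* Let $T>0$ and let $a,\kappa$ satisfy the assumptions of the context. Let $f\in C^1(\mathbb{R})$ be periodic with period $1$ and let $U$ be uniformly distributed on $[0,1]$. For each $P\in\mathbb{N}$ let $\zeta^1,\dots,\zeta^P\in[0,1]$ be points. Let $X^P=(X_i^P)_{i=1}^P$ be the solution of the particle system $$X_i^P(t)=f(\{\zeta^i+U\})+\int_0^t a\Big(X_i^P(s),\frac1P\sum_{j=1}^P\kappa(X_i^P(s),X_j^P(s))\Big)ds,\quad 1\le i\le P,\ t\in[0,T],$$ and let $Z=(Z_i)_{i=1}^P$ be the solutions of the mean-field ODE $$Z_i(t)=f(\{\zeta^i+U\})+\int_0^t a\Big(Z_i(s),\int\kappa(Z_i(s),z)\,\mathcal{L}(Z_i(s))(dz)\Big)ds,\quad t\in[0,T].$$ Let $g_P:\mathbb{R}^P\to\mathbb{R}$, $P\in\mathbb{N}$, be a family of bounded functions (not necessarily symmetric) with continuous partial derivatives up to order $2$ for which there is a constant $0<C<\infty$ with $$\sum_{k\in\mathbb{N}_0^P,\ 0\le|k|\le2}\left\|\frac{\partial^{|k|}}{\partial x^k}g_P\right\|_{L^\infty}\le C\quad\text{for all }P\in\mathbb{N}.$$ Then there is a constant $K$ not depending on $P$ such that for all $P$ $$\mathbb{E}\Big[\big(g_P(X^P(T))-g_P(Z(T))\big)^2\Big]\le K\sup_{x\in[0,1]}\Delta_{\{\zeta+x\}}^2 .$$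
   Context: Assumptions: $a:\mathbb{R}\times\mathbb{R}\to\mathbb{R}$ is bounded with continuous and bounded partial derivatives up to second order; $\kappa:\mathbb{R}\times\mathbb{R}\to\mathbb{R}$ is bounded with continuous and bounded first-order partial derivatives. Notation: $\{x\}$ is the fractional part of $x$; $\mathcal{L}(\cdot)$ is the law of a random variable (the $Z_i(s)$ all have the same law, since $f(\{\zeta^i+U\})$ has the law of $f(U)$ for every $i$). For points $\eta^1,\dots,\eta^P\in[0,1]$ the star discrepancy is $\Delta_\eta=\sup_{y\in[0,1]}\big|\frac1P\sum_{i=1}^P1_{[0,y]}(\eta^i)-y\big|$, and $\Delta_{\{\zeta+x\}}$ is the star discrepancy of the shifted points $\{\zeta^1+x\},\dots,\{\zeta^P+x\}$. *)

theory Defs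
  imports "HOL-Probability.Probability"
begin

section \<open>Bounded functions on the plane with bounded continuous partial derivatives\<close>

definition partial_fst :: "(real \<times> real \<Rightarrow> real) \<Rightarrow> real \<times> real \<Rightarrow> real" where
  "partial_fst h p = deriv (\<lambda>s. h (s, snd p)) (fst p)"

definition partial_snd :: "(real \<times> real \<Rightarrow> real) \<Rightarrow> real \<times> real \<Rightarrow> real" where
  "partial_snd h p = deriv (\<lambda>s. h (fst p, s)) (snd p)"

primrec Cb :: "nat \<Rightarrow> (real \<times> real \<Rightarrow> real) \<Rightarrow> bool" where
  "Cb 0 h \<longleftrightarrow> continuous_on UNIV h \<and> bounded (range h)"
| "Cb (Suc m) h \<longleftrightarrow> continuous_on UNIV h \<and> bounded (range h) \<and>
     (\<forall>x y. (\<lambda>s. h (s, y)) differentiable (at x)) \<and>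
     (\<forall>x y. (\<lambda>s. h (x, s)) differentiable (at y)) \<and>
     Cb m (partial_fst h) \<and> Cb m (partial_snd h)"

section \<open>Functions of $P$ real variables\<close>

text \<open>
  Since the dimension varies, points of $P$-dimensional real space are the functions on the
  naturals that are \<open>undefined\<close> outside \<open>{1..P}\<close>. This is also the underlying space
  of the product measure \<open>Pi\<^sub>M {1..P} (\<lambda>_. lborel)\<close>. Continuity refers to the product
  topology on functions, whose trace on this set is the usual topology.
\<close>

abbreviation Rspace :: "nat \<Rightarrow> (nat \<Rightarrow> real) set" where
  "Rspace P \<equiv> {1..P} \<rightarrow>\<^sub>E UNIV"

definition pderiv_at :: "nat \<Rightarrow> ((nat \<Rightarrow> real) \<Rightarrow> real) \<Rightarrow> (nat \<Rightarrow> real) \<Rightarrow> real" where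
  "pderiv_at i h x = deriv (\<lambda>s. h (x(i := s))) (x i)"

primrec Cn :: "nat \<Rightarrow> nat \<Rightarrow> ((nat \<Rightarrow> real) \<Rightarrow> real) \<Rightarrow> bool" where
  "Cn 0 P h \<longleftrightarrow> continuous_on (Rspace P) h"
| "Cn (Suc m) P h \<longleftrightarrow> continuous_on (Rspace P) h \<and>
     (\<forall>i\<in>{1..P}. (\<forall>x\<in>Rspace P. (\<lambda>s. h (x(i := s))) differentiable (at (x i))) \<and>
        Cn m P (pderiv_at i h))"

definition multi_indices :: "nat \<Rightarrow> nat \<Rightarrow> (nat \<Rightarrow> nat) set" where
  "multi_indices P m = {k \<in> {1..P} \<rightarrow>\<^sub>E UNIV. (\<Sum>i=1..P. k i) \<le> m}"

text \<open>The partial derivatives are taken in the order $\partial_1^{k_1} \cdots \partial_P^{k_P}$.\<close>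

definition multi_deriv ::
    "nat \<Rightarrow> (nat \<Rightarrow> nat) \<Rightarrow> ((nat \<Rightarrow> real) \<Rightarrow> real) \<Rightarrow> (nat \<Rightarrow> real) \<Rightarrow> real" where
  "multi_deriv P k h = foldr (\<lambda>i. pderiv_at i ^^ k i) [1..<Suc P] h"

definition Linf_norm :: "nat \<Rightarrow> ((nat \<Rightarrow> real) \<Rightarrow> real) \<Rightarrow> ennreal" where
  "Linf_norm P h = esssup (Pi\<^sub>M {1..P} (\<lambda>_. lborel)) (\<lambda>x. ennreal \<bar>h x\<bar>)"

text \<open>The index set of the sums over multi-indices is finite, so \<open>sum\<close> does not degenerate.\<close>

lemma finite_multi_indices: "finite (multi_indices P m)"
proof (rule finite_subset)
  show "multi_indices P m \<subseteq> {1..P} \<rightarrow>\<^sub>E {..m}"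
  proof
    fix k assume k: "k \<in> multi_indices P m"
    have "k i \<le> m" if "i \<in> {1..P}" for i
      using member_le_sum[of i "{1..P}" k] that k by (auto simp: multi_indices_def)
    then show "k \<in> {1..P} \<rightarrow>\<^sub>E {..m}"
      using k by (auto simp: multi_indices_def PiE_def)
  qed
qed (simp add: finite_PiE)

section \<open>Star discrepancy\<close>

definition star_discrepancy :: "nat \<Rightarrow> (nat \<Rightarrow> real) \<Rightarrow> real" where
  "star_discrepancy P \<eta> =
     (SUP y\<in>{0..1}. \<bar>(1 / real P) * (\<Sum>i=1..P. indicator {0..y} (\<eta> i)) - y\<bar>)"

section \<open>Solutions of the particle system and of the mean-field equation\<close>

text \<open>
  A family of processes takes the arguments particle index, time, sample point. The integral
  equations hold almost surely, simultaneously for all times in $[0,T]$; since the integral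
  is required to exist, solutions have almost surely continuous paths.
\<close>

definition particle_solution ::
    "'w measure \<Rightarrow> (real \<times> real \<Rightarrow> real) \<Rightarrow> (real \<times> real \<Rightarrow> real) \<Rightarrow> real \<Rightarrow> nat \<Rightarrow>
     (nat \<Rightarrow> 'w \<Rightarrow> real) \<Rightarrow> (nat \<Rightarrow> real \<Rightarrow> 'w \<Rightarrow> real) \<Rightarrow> bool" where
  "particle_solution M a \<kappa> T P X0 X \<longleftrightarrow>
     (\<forall>i\<in>{1..P}. \<forall>t\<in>{0..T}. X i t \<in> borel_measurable M) \<and>
     (AE \<omega> in M. \<forall>i\<in>{1..P}. \<forall>t\<in>{0..T}.
        ((\<lambda>s. a (X i s \<omega>, (1 / real P) * (\<Sum>j=1..P. \<kappa> (X i s \<omega>, X j s \<omega>))))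
          has_integral (X i t \<omega> - X0 i \<omega>)) {0..t})"

definition mean_field_solution ::
    "'w measure \<Rightarrow> (real \<times> real \<Rightarrow> real) \<Rightarrow> (real \<times> real \<Rightarrow> real) \<Rightarrow> real \<Rightarrow>
     ('w \<Rightarrow> real) \<Rightarrow> (real \<Rightarrow> 'w \<Rightarrow> real) \<Rightarrow> bool" where
  "mean_field_solution M a \<kappa> T Z0 Z \<longleftrightarrow>
     (\<forall>t\<in>{0..T}. Z t \<in> borel_measurable M) \<and>
     (AE \<omega> in M. \<forall>t\<in>{0..T}.
        ((\<lambda>s. a (Z s \<omega>, \<integral>z. \<kappa> (Z s \<omega>, z) \<partial>(distr M borel (Z s))))
          has_integral (Z t \<omega> - Z0 \<omega>)) {0..t})"

end

theory Submission
  imports Defs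
begin

text \<open>
  The stability estimate for integral equations is obtained from a supremum weighted by
  \<open>exp (- 2 * L * t)\<close>, in which the Lipschitz part of the right-hand side contributes only half
  of the supremum. Applied to two sample points it shows that a mean-field solution
  at time $s$ is almost surely a Lipschitz function $\psi_s$ of its label
  $V = \{\zeta + U\}$, which is uniformly distributed. Applied to pairs of nearby labels it shows
  that $\psi_s$ does not depend on the solution. Hence, for fixed $x$, the empirical average of
  $\kappa(x, Z_j(s))$ is a quadrature rule for the Lipschitz function $\kappa(x, \psi_s(\cdot))$ at the
  nodes $\{\zeta^j + U\}$, and by Koksma's inequality its error is at most a constant times their
  discrepancy. A last application to particles against mean-field solutions gives
  $\max_i |X_i - Z_i| \le K \Delta$ almost surely, and the hypothesis on $g_P$
  makes $g_P$ Lipschitz in the maximum norm with constant $C$.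
\<close>

section \<open>Integral equations and Lipschitz functions\<close>

text \<open>Let S be the supremum of exp(-2Lt) |x_j(t) - y_j(t)| over all j and t, which the bound
  \<open>B\<close> makes finite. The Lipschitz part of the integrand is at most L S exp(2Ls), so it
  contributes at most S/2 to the weighted difference, and S <= delta + eta T + S/2. The majorant
  exp(2Ls) is integrable even for infinite \<open>J\<close>, whereas a supremum over j at each time
  need not be measurable in time.\<close>

lemma integral_equation_stability:
  fixes x y F G :: "'j \<Rightarrow> real \<Rightarrow> real"
  assumes x: "\<And>j t. j \<in> J \<Longrightarrow> t \<in> {0..T} \<Longrightarrow> (F j has_integral (x j t - x0 j)) {0..t}"
    and y: "\<And>j t. j \<in> J \<Longrightarrow> t \<in> {0..T} \<Longrightarrow> (G j has_integral (y j t - y0 j)) {0..t}"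
    and init: "\<And>j. j \<in> J \<Longrightarrow> \<bar>x0 j - y0 j\<bar> \<le> \<delta>"
    and bounded: "\<And>j s. j \<in> J \<Longrightarrow> s \<in> {0..T} \<Longrightarrow> \<bar>F j s - G j s\<bar> \<le> B"
    and lip: "\<And>j s E. j \<in> J \<Longrightarrow> s \<in> {0..T} \<Longrightarrow> (\<forall>k\<in>J. \<bar>x k s - y k s\<bar> \<le> E) \<Longrightarrow>
                \<bar>F j s - G j s\<bar> \<le> L * E + \<eta>"
    and "L > 0" "\<eta> \<ge> 0"
    and j: "j \<in> J" and t: "t \<in> {0..T}"
  shows "\<bar>x j t - y j t\<bar> \<le> 2 * exp (2 * L * T) * (\<delta> + \<eta> * T)"
proof -
  have diff_le: "\<bar>x j t - y j t\<bar> \<le> \<delta> + integral {0..t} h"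
    if j: "j \<in> J" and t: "t \<in> {0..T}" and h: "h integrable_on {0..t}"
      and le: "\<And>s. s \<in> {0..t} \<Longrightarrow> \<bar>F j s - G j s\<bar> \<le> h s" for j t h
  proof -
    have hi: "((\<lambda>s. F j s - G j s) has_integral ((x j t - x0 j) - (y j t - y0 j))) {0..t}"
      using has_integral_diff[OF x[OF j t] y[OF j t]] .
    have "norm (integral {0..t} (\<lambda>s. F j s - G j s)) \<le> integral {0..t} h"
      using hi h le by (intro integral_norm_bound_integral) auto
    then have "\<bar>(x j t - x0 j) - (y j t - y0 j)\<bar> \<le> integral {0..t} h"
      using integral_unique[OF hi] by simp
    with init[OF j] show ?thesis by linarith
  qed
  define D where "D = (\<lambda>(j, t). exp (- (2 * L * t)) * \<bar>x j t - y j t\<bar>) ` (J \<times> {0..T})"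
  have "0 \<le> T" using t by auto
  have "0 \<le> \<delta>" using init[OF j] by linarith
  have "0 \<le> B" using bounded[OF j, of 0] \<open>0 \<le> T\<close> by auto
  have "D \<noteq> {}" using j t by (auto simp: D_def)
  have D_bdd: "bdd_above D"
  proof (rule bdd_aboveI)
    fix d assume "d \<in> D"
    then obtain j t where jt: "j \<in> J" "t \<in> {0..T}" and d: "d = exp (- (2 * L * t)) * \<bar>x j t - y j t\<bar>"
      by (auto simp: D_def)
    have "\<bar>x j t - y j t\<bar> \<le> \<delta> + integral {0..t} (\<lambda>s. B)"
      using jt bounded by (intro diff_le) auto
    also have "integral {0..t} (\<lambda>s. B) \<le> T * B"
      using jt \<open>0 \<le> B\<close> by (auto intro: mult_right_mono)
    finally have "\<bar>x j t - y j t\<bar> \<le> \<delta> + T * B" by simp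
    moreover have "d \<le> \<bar>x j t - y j t\<bar>"
      unfolding d using jt \<open>L > 0\<close> by (intro mult_left_le_one_le) auto
    ultimately show "d \<le> \<delta> + T * B" by linarith
  qed
  define S where "S = Sup D"
  have S_upper: "\<bar>x j t - y j t\<bar> \<le> S * exp (2 * L * t)" if "j \<in> J" "t \<in> {0..T}" for j t
  proof -
    have "exp (- (2 * L * t)) * \<bar>x j t - y j t\<bar> \<le> S"
      unfolding S_def using that D_bdd by (intro cSup_upper) (auto simp: D_def)
    then have "exp (2 * L * t) * (exp (- (2 * L * t)) * \<bar>x j t - y j t\<bar>) \<le> exp (2 * L * t) * S"
      by (intro mult_left_mono) auto
    then show ?thesis by (simp add: exp_minus field_simps)
  qed
  have "0 \<le> S"
    using S_upper[OF j, of 0] \<open>0 \<le> T\<close> by simp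
  have "S \<le> \<delta> + \<eta> * T + S / 2"
    unfolding S_def
  proof (rule cSup_least[OF \<open>D \<noteq> {}\<close>], fold S_def)
    fix d assume "d \<in> D"
    then obtain j t where jt: "j \<in> J" "t \<in> {0..T}" and d: "d = exp (- (2 * L * t)) * \<bar>x j t - y j t\<bar>"
      by (auto simp: D_def)
    \<comment> \<open>The exponent 2L, twice the Lipschitz rate, is what produces the factor 1/2 in
      this antiderivative.\<close>
    have hi: "((\<lambda>s. L * (S * exp (2 * L * s)) + \<eta>) has_integral
        ((S / 2 * exp (2 * L * t) + \<eta> * t) - (S / 2 * exp (2 * L * 0) + \<eta> * 0))) {0..t}"
      using jt by (intro fundamental_theorem_of_calculus)
        (auto intro!: derivative_eq_intros simp flip: has_real_derivative_iff_has_vector_derivative)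
    have "\<bar>x j t - y j t\<bar> \<le> \<delta> + integral {0..t} (\<lambda>s. L * (S * exp (2 * L * s)) + \<eta>)"
      using jt hi by (intro diff_le lip ballI S_upper) auto
    also have "\<dots> = \<delta> + (S / 2 * exp (2 * L * t) + \<eta> * t - S / 2)"
      using integral_unique[OF hi] by simp
    also have "\<dots> \<le> (\<delta> + \<eta> * t) + S / 2 * exp (2 * L * t)" using \<open>0 \<le> S\<close> by simp
    finally have "d \<le> exp (- (2 * L * t)) * ((\<delta> + \<eta> * t) + S / 2 * exp (2 * L * t))"
      unfolding d by (intro mult_left_mono) auto
    also have "\<dots> = exp (- (2 * L * t)) * (\<delta> + \<eta> * t) + S / 2"
      by (simp add: exp_minus field_simps)
    also have "exp (- (2 * L * t)) * (\<delta> + \<eta> * t) \<le> \<delta> + \<eta> * t"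
      using jt \<open>0 \<le> \<delta>\<close> \<open>\<eta> \<ge> 0\<close> \<open>L > 0\<close> by (intro mult_left_le_one_le) auto
    also have "\<eta> * t \<le> \<eta> * T" using jt \<open>\<eta> \<ge> 0\<close> by (auto intro: mult_left_mono)
    finally show "d \<le> \<delta> + \<eta> * T + S / 2" by simp
  qed
  then have S_le: "S \<le> 2 * (\<delta> + \<eta> * T)" by simp
  have "\<bar>x j t - y j t\<bar> \<le> S * exp (2 * L * t)" by (rule S_upper[OF j t])
  also have "\<dots> \<le> (2 * (\<delta> + \<eta> * T)) * exp (2 * L * T)"
    using S_le \<open>0 \<le> S\<close> t \<open>L > 0\<close> by (intro mult_mono) auto
  finally show ?thesis by (simp add: algebra_simps)
qed

text \<open>Equal labels force equal values, so \<open>y\<close> factors through \<open>v\<close> on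
  \<open>G\<close>. Extending the factor to the whole line makes it continuous and hence Borel,
  although no measurability of \<open>G\<close> or of its image under \<open>v\<close> is
  available.\<close>

lemma lipschitz_factorization:
  fixes v y :: "'w \<Rightarrow> real"
  assumes lip: "\<And>p q. p \<in> G \<Longrightarrow> q \<in> G \<Longrightarrow> \<bar>y p - y q\<bar> \<le> L * \<bar>v p - v q\<bar>"
    and "L \<ge> 0"
  obtains \<psi> where "\<And>p. p \<in> G \<Longrightarrow> \<psi> (v p) = y p" "L-lipschitz_on UNIV \<psi>"
proof (cases "G = {}")
  case True
  then show ?thesis using that[of "\<lambda>_. 0"] \<open>L \<ge> 0\<close> by (auto simp: lipschitz_on_def)
next
  case False
  then obtain q0 where q0: "q0 \<in> G" by auto
  text \<open>McShane's extension formula.\<close>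
  define \<psi> where "\<psi> u = (INF p\<in>G. y p + L * \<bar>u - v p\<bar>)" for u
  have bdd: "bdd_below ((\<lambda>p. y p + L * \<bar>u - v p\<bar>) ` G)" for u
  proof (rule bdd_belowI2)
    fix p assume "p \<in> G"
    have "y q0 - y p \<le> L * \<bar>v q0 - v p\<bar>" using lip[OF q0 \<open>p \<in> G\<close>] by linarith
    also have "\<dots> \<le> L * (\<bar>u - v q0\<bar> + \<bar>u - v p\<bar>)" using \<open>L \<ge> 0\<close> by (intro mult_left_mono) auto
    finally show "y q0 - L * \<bar>u - v q0\<bar> \<le> y p + L * \<bar>u - v p\<bar>" by (simp add: algebra_simps)
  qed
  have one_sided: "\<psi> u \<le> \<psi> w + L * \<bar>u - w\<bar>" for u w
  proof -
    have "\<psi> u - L * \<bar>u - w\<bar> \<le> \<psi> w"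
      unfolding \<psi>_def[of w]
    proof (rule cINF_greatest[OF False])
      fix p assume "p \<in> G"
      then have "\<psi> u \<le> y p + L * \<bar>u - v p\<bar>" unfolding \<psi>_def by (intro cINF_lower bdd)
      also have "L * \<bar>u - v p\<bar> \<le> L * (\<bar>u - w\<bar> + \<bar>w - v p\<bar>)"
        using \<open>L \<ge> 0\<close> by (intro mult_left_mono) auto
      finally show "\<psi> u - L * \<bar>u - w\<bar> \<le> y p + L * \<bar>w - v p\<bar>" by (simp add: algebra_simps)
    qed
    then show ?thesis by simp
  qed
  have "L-lipschitz_on UNIV \<psi>"
  proof (rule lipschitz_onI)
    fix u w show "dist (\<psi> u) (\<psi> w) \<le> L * dist u w"
      using one_sided[of u w] one_sided[of w u] by (simp add: dist_real_def abs_le_iff abs_minus_commute)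
  qed fact
  moreover have "\<psi> (v p) = y p" if "p \<in> G" for p
  proof (rule antisym)
    show "\<psi> (v p) \<le> y p"
      unfolding \<psi>_def using cINF_lower[OF bdd that, of "v p"] by simp
    show "y p \<le> \<psi> (v p)"
      unfolding \<psi>_def using lip[OF that] by (intro cINF_greatest[OF False]) (fastforce simp: abs_le_iff)
  qed
  ultimately show ?thesis using that by blast
qed

text \<open>Up to a null set, shifting by c modulo 1 translates [0, 1 - c) and [1 - c, 1] so that
  they exchange places in [0, 1]. The law is then identified through its distribution
  function.\<close>

lemma frac_shift_uniform:
  fixes U :: "'w \<Rightarrow> real"
  assumes "prob_space M" and U: "U \<in> borel_measurable M"
    and distr_U: "distr M borel U = uniform_measure lborel {0..1}"
    and c: "c \<in> {0..1}"
  shows "distr M borel (\<lambda>\<omega>. frac (c + U \<omega>)) = uniform_measure lborel {0..1}"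
proof -
  interpret prob_space M by fact
  let ?u = "uniform_measure lborel {0..1::real}"
  let ?S = "\<lambda>x. frac (c + x)"
  have S[measurable]: "?S \<in> borel_measurable borel" by (simp add: frac_def) measurable
  interpret u: real_distribution ?u
    unfolding real_distribution_def real_distribution_axioms_def
    by (auto intro!: prob_space_uniform_measure)
  interpret d: real_distribution "distr ?u borel ?S"
    unfolding real_distribution_def real_distribution_axioms_def
    by (auto intro!: u.prob_space_distr)
  have AE_S: "AE x in ?u. ?S x = (if x < 1 - c then c + x else c + x - 1)"
  proof -
    \<comment> \<open>At x = 2 - c the sum c + x is 2, with fractional part 0 instead of c + x - 1 =
      1. This point lies in [0, 1] only when c = 1.\<close>
    have "AE x in lborel. x \<noteq> (2 - c :: real)" by (rule AE_lborel_singleton)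
    then have "AE x in lborel. x \<in> {0..1} \<longrightarrow> ?S x = (if x < 1 - c then c + x else c + x - 1)"
    proof eventually_elim
      case (elim x)
      show ?case
      proof
        assume x: "x \<in> {0..1}"
        show "?S x = (if x < 1 - c then c + x else c + x - 1)"
        proof (cases "x < 1 - c")
          case True
          then show ?thesis using x c by (auto simp: frac_eq)
        next
          case False
          have "frac (c + x) = frac (c + x - 1 + 1)" by simp
          also have "\<dots> = frac (c + x - 1)" by (rule frac_1_eq)
          also have "\<dots> = c + x - 1" using False x c elim by (auto simp: frac_eq)
          finally show ?thesis using False by simp
        qed
      qed
    qed
    then show ?thesis by (subst AE_uniform_measure) auto
  qed
  have unif: "measure ?u A = measure lborel ({0..1} \<inter> A)" if "A \<in> sets borel" for A
    using that by (subst measure_uniform_measure) auto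
  have "distr ?u borel ?S = ?u"
  proof (rule cdf_unique[OF d.real_distribution_axioms u.real_distribution_axioms], rule ext)
    fix y :: real
    have "cdf (distr ?u borel ?S) y = measure ?u {x. ?S x \<le> y}"
      by (auto simp: cdf_def measure_distr vimage_def)
    also have "\<dots> = measure ?u ({x. x < 1 - c \<and> c + x \<le> y} \<union> {x. 1 - c \<le> x \<and> c + x - 1 \<le> y})"
      using AE_S by (intro u.finite_measure_eq_AE) (auto simp: frac_def)
    also have "\<dots> = measure lborel ({0..1} \<inter> ({x. x < 1 - c \<and> c + x \<le> y} \<union> {x. 1 - c \<le> x \<and> c + x - 1 \<le> y}))"
      by (rule unif) auto
    also have "\<dots> = measure lborel ({0..1} \<inter> {..y})"
    proof -
      \<comment> \<open>In these four cases the preimage is empty, one interval of length y, two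
        intervals of lengths y - c and c, or all of [0, 1].\<close>
      consider "y < 0" | "0 \<le> y" "y < c" | "c \<le> y" "y < 1" | "1 \<le> y" by linarith
      then show ?thesis
      proof cases
        case 1
        then have "{0..1} \<inter> ({x. x < 1 - c \<and> c + x \<le> y} \<union> {x. 1 - c \<le> x \<and> c + x - 1 \<le> y}) = {}" "{0..1} \<inter> {..y} = {}"
          using c by auto
        then show ?thesis by simp
      next
        case 2
        then have "{0..1} \<inter> ({x. x < 1 - c \<and> c + x \<le> y} \<union> {x. 1 - c \<le> x \<and> c + x - 1 \<le> y}) = {1 - c..1 - c + y}" "{0..1} \<inter> {..y} = {0..y}"
          using c by auto
        then show ?thesis using 2 by simp
      next
        case 3
        then have "{0..1} \<inter> ({x. x < 1 - c \<and> c + x \<le> y} \<union> {x. 1 - c \<le> x \<and> c + x - 1 \<le> y}) = {0..y - c} \<union> {1 - c..1}" "{0..1} \<inter> {..y} = {0..y}"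
          using c by auto
        moreover have "measure lborel ({0..y - c} \<union> {1 - c..1}) = measure lborel {0..y - c} + measure lborel {1 - c..1}"
          using 3 c by (intro measure_Union) (auto simp: emeasure_lborel_Icc_eq)
        ultimately show ?thesis using 3 c by simp
      next
        case 4
        then have "{0..1} \<inter> ({x. x < 1 - c \<and> c + x \<le> y} \<union> {x. 1 - c \<le> x \<and> c + x - 1 \<le> y}) = {0..1}" "{0..1} \<inter> {..y} = {0..1}"
          using c by auto
        then show ?thesis by simp
      qed
    qed
    also have "\<dots> = cdf ?u y" by (simp add: cdf_def unif)
    finally show "cdf (distr ?u borel ?S) y = cdf ?u y" .
  qed
  moreover have "distr M borel (\<lambda>\<omega>. frac (c + U \<omega>)) = distr (distr M borel U) borel ?S"
    using U by (subst distr_distr) (auto simp: comp_def)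
  ultimately show ?thesis using distr_U by simp
qed

section \<open>Lipschitz constants from bounds on derivatives, in one, two and P variables\<close>

lemma abs_diff_le_of_deriv_bound:
  fixes h :: "real \<Rightarrow> real"
  assumes "\<And>s. h differentiable (at s)" and "\<And>s. \<bar>deriv h s\<bar> \<le> c"
  shows "\<bar>h u - h v\<bar> \<le> c * \<bar>u - v\<bar>"
proof -
  have "(h has_field_derivative deriv h s) (at s within UNIV)" for s
    using assms(1)[of s] by (simp add: DERIV_deriv_iff_real_differentiable)
  then have "norm (h u - h v) \<le> c * norm (u - v)"
    using assms(2) by (intro field_differentiable_bound[of UNIV]) auto
  then show ?thesis by simp
qed

lemma Cb_bounded:
  assumes "Cb m h"
  obtains B where "B > 0" "\<And>p. \<bar>h p\<bar> \<le> B"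
proof -
  have "bounded (range h)" using assms by (cases m) auto
  then show ?thesis using that by (auto simp: bounded_pos)
qed

lemma Cb_Suc_lipschitz:
  assumes "Cb (Suc m) h"
  obtains L where "L > 0" "\<And>x y x' y'. \<bar>h (x, y) - h (x', y')\<bar> \<le> L * (\<bar>x - x'\<bar> + \<bar>y - y'\<bar>)"
proof -
  obtain B1 where B1: "B1 > 0" "\<And>p. \<bar>partial_fst h p\<bar> \<le> B1"
    using assms by (auto elim: Cb_bounded)
  obtain B2 where B2: "B2 > 0" "\<And>p. \<bar>partial_snd h p\<bar> \<le> B2"
    using assms by (auto elim: Cb_bounded)
  have "\<bar>h (x, y) - h (x', y')\<bar> \<le> (B1 + B2) * (\<bar>x - x'\<bar> + \<bar>y - y'\<bar>)" for x y x' y'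
  proof -
    have "\<bar>h (x, y) - h (x', y)\<bar> \<le> B1 * \<bar>x - x'\<bar>"
      using assms B1(2)[of "(_, y)"]
      by (intro abs_diff_le_of_deriv_bound[of "\<lambda>s. h (s, y)"]) (auto simp: partial_fst_def)
    moreover have "\<bar>h (x', y) - h (x', y')\<bar> \<le> B2 * \<bar>y - y'\<bar>"
      using assms B2(2)[of "(x', _)"]
      by (intro abs_diff_le_of_deriv_bound[of "\<lambda>s. h (x', s)"]) (auto simp: partial_snd_def)
    moreover have "0 \<le> B1 * \<bar>y - y'\<bar>" "0 \<le> B2 * \<bar>x - x'\<bar>" using B1 B2 by auto
    ultimately show ?thesis unfolding distrib_left distrib_right by linarith
  qed
  then show ?thesis using that[of "B1 + B2"] B1 B2 by auto
qed

lemma C1_lipschitz_on_Icc: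
  fixes f :: "real \<Rightarrow> real"
  assumes "f C1_differentiable_on UNIV"
  obtains L where "L \<ge> 0" "\<And>x y. x \<in> {a..b} \<Longrightarrow> y \<in> {a..b} \<Longrightarrow> \<bar>f x - f y\<bar> \<le> L * \<bar>x - y\<bar>"
proof -
  obtain D where D: "\<And>x. (f has_vector_derivative D x) (at x)" "continuous_on UNIV D"
    using assms by (auto simp: C1_differentiable_on_def)
  have "bounded (D ` {a..b})"
    using D(2) by (intro compact_imp_bounded compact_continuous_image) (auto intro: continuous_on_subset)
  then obtain L where L: "L > 0" "\<And>x. x \<in> {a..b} \<Longrightarrow> \<bar>D x\<bar> \<le> L" by (auto simp: bounded_pos)
  have "\<bar>f x - f y\<bar> \<le> L * \<bar>x - y\<bar>" if "x \<in> {a..b}" "y \<in> {a..b}" for x y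
  proof -
    have "norm (f x - f y) \<le> L * norm (x - y)"
      using that L D(1)
      by (intro field_differentiable_bound[of "{a..b}" f D])
        (auto simp: has_real_derivative_iff_has_vector_derivative intro: has_vector_derivative_at_within)
    then show ?thesis by simp
  qed
  then show ?thesis using that[of L] L by auto
qed

text \<open>By continuity, a value above the essential supremum would be exceeded nowhere less than
  on a whole open box around x, which has positive product measure.\<close>

lemma abs_le_Linf_norm:
  assumes cont: "continuous_on (Rspace P) h" and x: "x \<in> Rspace P"
  shows "ennreal \<bar>h x\<bar> \<le> Linf_norm P h"
proof (rule ccontr)
  let ?M = "Pi\<^sub>M {1..P} (\<lambda>_. lborel :: real measure)"
  assume "\<not> ennreal \<bar>h x\<bar> \<le> Linf_norm P h"
  then have less: "Linf_norm P h < ennreal \<bar>h x\<bar>" by simp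
  then obtain c where c: "Linf_norm P h = ennreal c" "0 \<le> c" "c < \<bar>h x\<bar>"
    by (cases "Linf_norm P h") (auto simp: ennreal_less_iff)
  have "openin (top_of_set (Rspace P)) (Rspace P \<inter> (\<lambda>z. \<bar>h z\<bar>) -` {c<..})"
    using cont by (intro continuous_openin_preimage_gen continuous_on_rabs) auto
  then obtain A where A: "open A" "Rspace P \<inter> (\<lambda>z. \<bar>h z\<bar>) -` {c<..} = Rspace P \<inter> A"
    by (auto simp: openin_open)
  have "x \<in> A" using A(2) x c(3) by auto
  with A(1) obtain X where X: "x \<in> (\<Pi>\<^sub>E i\<in>UNIV. X i)" "\<And>i. open (X i)" "(\<Pi>\<^sub>E i\<in>UNIV. X i) \<subseteq> A"
    using product_topology_open_contains_basis[of "\<lambda>_. euclidean" UNIV A x]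
    by (auto simp: open_fun_def)
  \<comment> \<open>The basic neighbourhood \<open>X\<close> constrains every natural coordinate,
    while the product measure sees only those in \<open>{1..P}\<close>. The other coordinates of
    points of \<open>Rspace P\<close> are all \<open>undefined\<close>, so they agree with those of
    x and stay in \<open>X\<close>.\<close>
  define Q where "Q = (\<Pi>\<^sub>E i\<in>{1..P}. X i)"
  have Q_sub: "z \<in> Rspace P" "c < \<bar>h z\<bar>" if z: "z \<in> Q" for z
  proof -
    show zR: "z \<in> Rspace P" using z by (auto simp: Q_def PiE_def)
    have "z i \<in> X i" for i
    proof (cases "i \<in> {1..P}")
      case False
      then have "z i = x i" using zR x by (auto simp: PiE_def extensional_def)
      then show ?thesis using X(1) by auto
    qed (use z in \<open>auto simp: Q_def\<close>)
    then have "z \<in> A" using X(3) by auto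
    then show "c < \<bar>h z\<bar>" using A(2) zR by auto
  qed
  interpret product_sigma_finite "\<lambda>_ :: nat. lborel :: real measure"
    by (simp add: product_sigma_finite_def lborel.sigma_finite_measure_axioms)
  have "emeasure lborel (X i) > 0" for i
  proof -
    obtain e where "e > 0" "ball (x i) e \<subseteq> X i"
      using X(1,2) open_contains_ball by (metis PiE_mem UNIV_I)
    then have "emeasure lborel {x i - e<..<x i + e} \<le> emeasure lborel (X i)"
      using X(2)[of i] by (intro emeasure_mono) (auto simp: ball_eq_greaterThanLessThan)
    moreover have "0 < emeasure lborel {x i - e<..<x i + e}" using \<open>e > 0\<close> by simp
    ultimately show ?thesis by (rule order.strict_trans2[rotated])
  qed
  moreover have "emeasure ?M Q = (\<Prod>i\<in>{1..P}. emeasure lborel (X i))"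
    unfolding Q_def using X(2) by (intro emeasure_PiM) auto
  ultimately have "emeasure ?M Q \<noteq> 0" by (simp add: prod_zero_iff zero_less_iff_neq_zero)
  moreover have "Q \<in> sets ?M" unfolding Q_def using X(2) by (intro sets_PiM_I_finite) auto
  moreover have AE_Q: "AE z in ?M. z \<notin> Q"
    using esssup_AE[where M = ?M and f = "\<lambda>z. ennreal \<bar>h z\<bar>"]
  proof eventually_elim
    case (elim z)
    then have "ennreal \<bar>h z\<bar> \<le> ennreal c" by (simp add: Linf_norm_def flip: c(1))
    then show ?case using Q_sub(2)[of z] c(2) by auto
  qed
  ultimately show False using AE_iff_null_sets[of Q ?M] by (simp add: null_sets_def del: One_nat_def)
qed

text \<open>Passing from y to x one coordinate at a time costs at most the sum over i of c_i |x_i -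
  y_i|, where c_i is the norm of the i-th first partial derivative. The hypothesis bounds the sum of
  the c_i, not each one separately, so the Lipschitz constant in the maximum norm carries no factor
  P.\<close>

lemma lipschitz_of_Linf_bound:
  assumes Cn: "Cn (Suc m) P g" and n: "1 \<le> n"
    and C: "(\<Sum>k\<in>multi_indices P n. Linf_norm P (multi_deriv P k g)) \<le> ennreal C" "C \<ge> 0"
    and x: "x \<in> Rspace P" and y: "y \<in> Rspace P"
    and r: "\<And>i. i \<in> {1..P} \<Longrightarrow> \<bar>x i - y i\<bar> \<le> r" "r \<ge> 0"
  shows "\<bar>g x - g y\<bar> \<le> C * r"
proof -
  \<comment> \<open>These unit multi-indices pick the first-order terms out of the sum over all
    multi-indices.\<close>
  define e where "e i = (\<lambda>j\<in>{1..P}. if j = i then 1 else 0 :: nat)" for i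
  define N where "N i = Linf_norm P (pderiv_at i g)" for i
  have e_mem: "e i \<in> multi_indices P n" if "i \<in> {1..P}" for i
    using n that by (auto simp: multi_indices_def e_def)
  have e_eq: "e i j = (if j = i then 1 else 0)" if "j \<in> {1..P}" for i j
    using that by (simp add: e_def)
  have e_inj: "inj_on e {1..P}"
  proof (rule inj_onI)
    fix i j assume ij: "i \<in> {1..P}" "e i = e j"
    from ij(2) have "e i i = e j i" by (rule fun_cong)
    then show "i = j" unfolding e_eq[OF ij(1)] by (simp split: if_split_asm)
  qed
  have deriv_e: "multi_deriv P (e i) g = pderiv_at i g" if i: "i \<in> {1..P}" for i
  proof -
    have "foldr (\<lambda>j. pderiv_at j ^^ e i j) xs g = (if i \<in> set xs then pderiv_at i g else g)"
      if "distinct xs" "set xs \<subseteq> {1..P}" for xs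
      using that
    proof (induction xs)
      case (Cons j xs)
      then show ?case using e_eq[of j i] by (cases "j = i") simp_all
    qed simp
    from this[of "[1..<Suc P]"] show ?thesis
      unfolding multi_deriv_def using i by (auto simp: subset_iff simp del: upt_Suc)
  qed
  have "(\<Sum>i=1..P. N i) = (\<Sum>k\<in>e ` {1..P}. Linf_norm P (multi_deriv P k g))"
    using e_inj deriv_e by (simp add: sum.reindex N_def)
  also have "\<dots> \<le> (\<Sum>k\<in>multi_indices P n. Linf_norm P (multi_deriv P k g))"
    using e_mem by (intro sum_mono2 finite_multi_indices) auto
  finally have N_sum: "(\<Sum>i=1..P. N i) \<le> ennreal C" using C by simp
  \<comment> \<open>\<open>enn2real\<close> sends infinity to 0, so finiteness must precede the
    passage to the real constants \<open>c i\<close>.\<close>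
  have N_fin: "N i < top" if "i \<in> {1..P}" for i
    using order.trans[OF member_le_sum[OF that, of N] N_sum] by (auto simp: le_less_trans)
  define c where "c i = enn2real (N i)" for i
  have "ennreal (\<Sum>i=1..P. c i) = (\<Sum>i=1..P. N i)"
    using N_fin by (subst sum_ennreal[symmetric]) (auto simp: c_def intro!: sum.cong)
  with N_sum have "ennreal (\<Sum>i=1..P. c i) \<le> ennreal C" by (simp only:)
  then have c_sum: "(\<Sum>i=1..P. c i) \<le> C" using C(2) by (subst (asm) ennreal_le_iff)
  have c_bound: "\<bar>pderiv_at i g z\<bar> \<le> c i" if "i \<in> {1..P}" "z \<in> Rspace P" for i z
  proof -
    have "continuous_on (Rspace P) (pderiv_at i g)" using Cn that by (cases m) auto
    from abs_le_Linf_norm[OF this that(2)] have "ennreal \<bar>pderiv_at i g z\<bar> \<le> ennreal (c i)"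
      using N_fin[OF that(1)] by (simp add: N_def c_def)
    then show ?thesis by (simp add: c_def)
  qed
  have step: "\<bar>g (z(i := s)) - g (z(i := t))\<bar> \<le> c i * \<bar>s - t\<bar>"
    if i: "i \<in> {1..P}" and z: "z \<in> Rspace P" for i z s t
  proof (rule abs_diff_le_of_deriv_bound[of "\<lambda>s. g (z(i := s))"])
    fix s
    have z': "z(i := s) \<in> Rspace P" using z i by (auto simp: PiE_def extensional_def)
    then have "(\<lambda>s'. g ((z(i := s))(i := s'))) differentiable (at ((z(i := s)) i))"
      using Cn i unfolding Cn.simps by blast
    then show "(\<lambda>s. g (z(i := s))) differentiable (at s)" by simp
    show "\<bar>deriv (\<lambda>s. g (z(i := s))) s\<bar> \<le> c i"
      using c_bound[OF i z'] by (simp add: pderiv_at_def)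
  qed
  \<comment> \<open>The hybrid points take their first k coordinates from x and the others from y;
    outside \<open>{1..P}\<close> both are \<open>undefined\<close>, so the hybrid for k = P is x
    itself.\<close>
  have "\<bar>g (\<lambda>i. if i \<in> {1..k} then x i else y i) - g y\<bar> \<le> (\<Sum>i=1..k. c i * r)" if "k \<le> P" for k
    using that
  proof (induction k)
    case 0
    then show ?case by simp
  next
    case (Suc k)
    define z where "z = (\<lambda>i. if i \<in> {1..k} then x i else y i)"
    have z: "z \<in> Rspace P" using x y by (auto simp: z_def PiE_def extensional_def)
    have "(\<lambda>i. if i \<in> {1..Suc k} then x i else y i) = z(Suc k := x (Suc k))"
      by (auto simp: z_def fun_eq_iff)
    moreover have "z = z(Suc k := y (Suc k))" by (auto simp: z_def fun_eq_iff)
    ultimately have "\<bar>g (\<lambda>i. if i \<in> {1..Suc k} then x i else y i) - g z\<bar>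
        \<le> c (Suc k) * \<bar>x (Suc k) - y (Suc k)\<bar>"
      using step[of "Suc k" z "x (Suc k)" "y (Suc k)"] Suc.prems z by simp
    also have "\<dots> \<le> c (Suc k) * r"
      using r(1) Suc.prems by (intro mult_left_mono) (auto simp: c_def)
    finally show ?case using Suc by (simp add: z_def)
  qed
  from this[of P] have "\<bar>g (\<lambda>i. if i \<in> {1..P} then x i else y i) - g y\<bar> \<le> (\<Sum>i=1..P. c i) * r"
    by (simp add: sum_distrib_right)
  moreover have "(\<lambda>i. if i \<in> {1..P} then x i else y i) = x"
    using x y by (auto simp: fun_eq_iff PiE_def extensional_def)
  ultimately show ?thesis using c_sum r(2) mult_right_mono[of "\<Sum>i=1..P. c i" C r] by simp
qed

section \<open>Star discrepancy\<close>

lemma discrepancy_term_bound: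
  assumes "y \<in> {0..1}"
  shows "\<bar>(1 / real P) * (\<Sum>i=1..P. indicator {0..y} (\<eta> i)) - y\<bar> \<le> 1"
proof -
  have "(\<Sum>i=1..P. indicator {0..y} (\<eta> i)) \<le> (\<Sum>i=1..P. 1 :: real)"
    by (intro sum_mono) (auto simp: indicator_def)
  \<comment> \<open>For P = 0 the factor \<open>1 / real P\<close> is 0, so the estimate covers this
    case as well.\<close>
  then have "(1 / real P) * (\<Sum>i=1..P. indicator {0..y} (\<eta> i)) \<le> 1"
    by (cases "P = 0") (auto simp: divide_simps)
  moreover have "0 \<le> (1 / real P) * (\<Sum>i=1..P. indicator {0..y} (\<eta> i))"
    by (intro mult_nonneg_nonneg sum_nonneg) auto
  ultimately show ?thesis using assms by (auto simp: abs_le_iff)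
qed

lemma discrepancy_term_le:
  assumes "y \<in> {0..1}"
  shows "\<bar>(1 / real P) * (\<Sum>i=1..P. indicator {0..y} (\<eta> i)) - y\<bar> \<le> star_discrepancy P \<eta>"
  unfolding star_discrepancy_def using assms
  by (intro cSUP_upper bdd_aboveI2[where M = 1] discrepancy_term_bound) auto

lemma star_discrepancy_nonneg: "0 \<le> star_discrepancy P \<eta>"
  by (rule order.trans[OF abs_ge_zero discrepancy_term_le[of 0]]) simp

lemma star_discrepancy_le_1: "star_discrepancy P \<eta> \<le> 1"
  unfolding star_discrepancy_def by (intro cSUP_least discrepancy_term_bound) auto

text \<open>For the indicator of [0, y] the quadrature error is bounded by the discrepancy by
  definition. A Lipschitz function is within L/N of a constant plus a combination of N such
  indicators whose coefficients are at most L/N in absolute value, so their total weight is at most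
  L for every N.\<close>

lemma koksma_lipschitz:
  fixes h :: "real \<Rightarrow> real"
  assumes h: "L-lipschitz_on UNIV h" and P: "P \<ge> 1"
    and \<eta>: "\<And>i. i \<in> {1..P} \<Longrightarrow> \<eta> i \<in> {0..1}"
  shows "\<bar>(1 / real P) * (\<Sum>i=1..P. h (\<eta> i)) - (\<integral>u. h u \<partial>uniform_measure lborel {0..1})\<bar>
    \<le> L * star_discrepancy P \<eta>"
proof -
  let ?u = "uniform_measure lborel {0..1::real}"
  let ?D = "star_discrepancy P \<eta>"
  interpret u: prob_space ?u by (rule prob_space_uniform_measure) auto
  have "L \<ge> 0" using h by (auto simp: lipschitz_on_def)
  have lip: "\<bar>h x - h y\<bar> \<le> L * \<bar>x - y\<bar>" for x y
    using lipschitz_onD[OF h] by (simp add: dist_real_def)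
  have AE_u: "AE x in ?u. x \<in> {0..1}" by (subst AE_uniform_measure) auto
  have h_meas: "h \<in> borel_measurable borel"
    using lipschitz_on_continuous_on[OF h] by (rule borel_measurable_continuous_onI)
  have h_int: "integrable ?u h"
  proof (rule u.integrable_const_bound[where B = "\<bar>h 0\<bar> + L"])
    show "AE x in ?u. norm (h x) \<le> \<bar>h 0\<bar> + L"
      using AE_u
    proof eventually_elim
      case (elim x)
      have "L * \<bar>x - 0\<bar> \<le> L * 1" using elim \<open>L \<ge> 0\<close> by (intro mult_left_mono) auto
      then show ?case using lip[of x 0] by simp
    qed
  qed (use h_meas in simp)
  have bound: "\<bar>(1 / real P) * (\<Sum>i=1..P. h (\<eta> i)) - (\<integral>u. h u \<partial>?u)\<bar> \<le> L * ?D + 2 * L * inverse (real (Suc n))" for n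
  proof -
    define N where "N = Suc n"
    define d where "d k = h (real (Suc k) / N) - h (real k / N)" for k
    \<comment> \<open>Since u <= k/N holds exactly when k >= ceil(N u), the sum telescopes on [0, 1]
      and s(u) = h(ceil(N u) / N). Writing it with the intervals [0, k/N] makes the discrepancy
      applicable term by term.\<close>
    define s where "s u = h 1 - (\<Sum>k<N. d k * indicator {0..real k / N} u)" for u
    have "N > 0" by (simp add: N_def)
    have d_le: "\<bar>d k\<bar> \<le> L / N" for k
      using lip[of "real (Suc k) / N" "real k / N"] by (simp add: d_def add_divide_distrib)
    have s_close: "\<bar>h u - s u\<bar> \<le> L / N" if u: "u \<in> {0..1}" for u
    proof -
      define m where "m = nat \<lceil>N * u\<rceil>"
      have m_iff: "u \<le> real k / N \<longleftrightarrow> m \<le> k" for k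
        using \<open>N > 0\<close> by (simp add: m_def pos_le_divide_eq mult.commute nat_le_iff ceiling_le_iff)
      have "m \<le> N" using m_iff[of N] u \<open>N > 0\<close> by simp
      have "(\<Sum>k<N. d k * indicator {0..real k / N} u) = (\<Sum>k\<in>{m..<N}. d k)"
        using u m_iff by (intro sum.mono_neutral_cong_right) (auto simp: indicator_def)
      also have "\<dots> = h 1 - h (real m / N)"
        using sum_Suc_diff'[OF \<open>m \<le> N\<close>, of "\<lambda>k. h (real k / N)"] \<open>N > 0\<close> by (simp add: d_def)
      finally have s: "s u = h (real m / N)" by (simp add: s_def)
      have "\<bar>u - real m / N\<bar> \<le> 1 / N"
      proof -
        have "real m = real_of_int \<lceil>N * u\<rceil>" using u by (simp add: m_def)
        then have "\<bar>N * u - m\<bar> \<le> 1" by linarith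
        then have "\<bar>(N * u - m) / N\<bar> \<le> 1 / N"
          unfolding abs_divide using \<open>N > 0\<close> by (simp add: divide_right_mono)
        then show ?thesis using \<open>N > 0\<close> by (simp add: diff_divide_distrib)
      qed
      then have "L * \<bar>u - real m / N\<bar> \<le> L * (1 / N)" using \<open>L \<ge> 0\<close> by (rule mult_left_mono)
      then show ?thesis using lip[of u "real m / N"] s by simp
    qed
    have ind_int: "integrable ?u (indicator {0..y} :: real \<Rightarrow> real)" for y
      by (rule integrable_real_indicator) (auto simp: u.emeasure_eq_measure)
    have s_int: "integrable ?u s" unfolding s_def
      by (intro Bochner_Integration.integrable_diff Bochner_Integration.integrable_sum
          integrable_mult_right ind_int) simp
    have int_s: "(\<integral>u. s u \<partial>?u) = h 1 - (\<Sum>k<N. d k * (real k / N))"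
    proof -
      have "(\<integral>u. indicator {0..real k / N} u \<partial>?u) = real k / N" if "k < N" for k
      proof -
        have "{0..1} \<inter> {0..real k / N} = {0..real k / N}" using that by auto
        then show ?thesis by (simp add: measure_uniform_measure)
      qed
      moreover have "(\<integral>u. s u \<partial>?u) = h 1 - (\<Sum>k<N. d k * (\<integral>u. indicator {0..real k / N} u \<partial>?u))"
      proof -
        have "(\<integral>u. s u \<partial>?u) = (\<integral>u. h 1 \<partial>?u) - (\<integral>u. (\<Sum>k<N. d k * indicator {0..real k / N} u) \<partial>?u)"
          unfolding s_def
          by (intro Bochner_Integration.integral_diff Bochner_Integration.integrable_sum
              integrable_mult_right ind_int) simp
        also have "(\<integral>u. (\<Sum>k<N. d k * indicator {0..real k / N} u) \<partial>?u)
            = (\<Sum>k<N. \<integral>u. d k * indicator {0..real k / N} u \<partial>?u)"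
          by (intro Bochner_Integration.integral_sum integrable_mult_right ind_int)
        also have "\<dots> = (\<Sum>k<N. d k * (\<integral>u. indicator {0..real k / N} u \<partial>?u))"
          by (intro sum.cong refl integral_mult_right_zero)
        finally show ?thesis by (simp add: u.prob_space)
      qed
      ultimately show ?thesis by simp
    qed
    have avg_s: "(1 / real P) * (\<Sum>i=1..P. s (\<eta> i)) =
        h 1 - (\<Sum>k<N. d k * ((1 / real P) * (\<Sum>i=1..P. indicator {0..real k / N} (\<eta> i))))"
    proof -
      define I where "I k u = (indicator {0..real k / N} u :: real)" for k u
      have "(\<Sum>i=1..P. s (\<eta> i)) = real P * h 1 - (\<Sum>k<N. d k * (\<Sum>i=1..P. I k (\<eta> i)))"
        unfolding s_def I_def[symmetric]
        by (simp add: sum_subtractf sum_distrib_left) (rule sum.swap)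
      then have "(1 / real P) * (\<Sum>i=1..P. s (\<eta> i)) = h 1 - (1 / real P) * (\<Sum>k<N. d k * (\<Sum>i=1..P. I k (\<eta> i)))"
        using P by (simp add: right_diff_distrib)
      then show ?thesis unfolding I_def[symmetric] by (simp add: sum_distrib_left mult_ac)
    qed
    \<comment> \<open>The constant h(1) cancels between average and integral, and only the errors of
      the indicators remain.\<close>
    have "\<bar>(1 / real P) * (\<Sum>i=1..P. s (\<eta> i)) - (\<integral>u. s u \<partial>?u)\<bar>
        = \<bar>\<Sum>k<N. d k * ((1 / real P) * (\<Sum>i=1..P. indicator {0..real k / N} (\<eta> i)) - real k / N)\<bar>"
      unfolding avg_s int_s by (simp add: right_diff_distrib sum_subtractf abs_minus_commute)
    also have "\<dots> \<le> (\<Sum>k<N. L / N * ?D)"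
    proof (rule order.trans[OF sum_abs sum_mono])
      fix k assume "k \<in> {..<N}"
      then show "\<bar>d k * ((1 / real P) * (\<Sum>i=1..P. indicator {0..real k / N} (\<eta> i)) - real k / N)\<bar> \<le> L / N * ?D"
        unfolding abs_mult
        using \<open>N > 0\<close> \<open>L \<ge> 0\<close> by (intro mult_mono d_le discrepancy_term_le) auto
    qed
    also have "\<dots> = L * ?D" using \<open>N > 0\<close> by simp
    finally have 1: "\<bar>(1 / real P) * (\<Sum>i=1..P. s (\<eta> i)) - (\<integral>u. s u \<partial>?u)\<bar> \<le> L * ?D" .
    have 2: "\<bar>(1 / real P) * (\<Sum>i=1..P. h (\<eta> i)) - (1 / real P) * (\<Sum>i=1..P. s (\<eta> i))\<bar> \<le> L / N"
    proof -
      have "\<bar>\<Sum>i=1..P. h (\<eta> i) - s (\<eta> i)\<bar> \<le> (\<Sum>i=1..P. L / N)"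
        using \<eta> s_close by (intro order.trans[OF sum_abs sum_mono]) auto
      then have "\<bar>(\<Sum>i=1..P. h (\<eta> i)) - (\<Sum>i=1..P. s (\<eta> i))\<bar> \<le> real P * (L / N)"
        by (simp add: sum_subtractf)
      then have "(1 / real P) * \<bar>(\<Sum>i=1..P. h (\<eta> i)) - (\<Sum>i=1..P. s (\<eta> i))\<bar> \<le> (1 / real P) * (real P * (L / N))"
        by (rule mult_left_mono) simp
      moreover have "(1 / real P) * \<bar>(\<Sum>i=1..P. h (\<eta> i)) - (\<Sum>i=1..P. s (\<eta> i))\<bar>
          = \<bar>(1 / real P) * (\<Sum>i=1..P. h (\<eta> i)) - (1 / real P) * (\<Sum>i=1..P. s (\<eta> i))\<bar>"
        by (simp add: abs_mult flip: right_diff_distrib diff_divide_distrib)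
      ultimately show ?thesis using P by simp
    qed
    have 3: "\<bar>(\<integral>u. h u \<partial>?u) - (\<integral>u. s u \<partial>?u)\<bar> \<le> L / N"
    proof -
      have "\<bar>\<integral>u. h u - s u \<partial>?u\<bar> \<le> (\<integral>u. \<bar>h u - s u\<bar> \<partial>?u)"
        using integral_norm_bound[of ?u "\<lambda>u. h u - s u"] by simp
      also have "\<dots> \<le> L / N"
        using h_int s_int AE_u s_close by (intro u.integral_le_const) auto
      finally show ?thesis using h_int s_int by simp
    qed
    have "L / N = L * inverse (real (Suc n))" by (simp add: N_def field_simps)
    then show ?thesis using 1 2 3 by linarith
  qed
  \<comment> \<open>The term 2L/N pays for replacing h by s in the average and in the integral; it
    vanishes as the partition is refined.\<close>
  have "(\<lambda>n. L * ?D + 2 * L * inverse (real (Suc n))) \<longlonglongrightarrow> L * ?D + 2 * L * 0"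
    by (intro tendsto_intros LIMSEQ_inverse_real_of_nat)
  from LIMSEQ_le_const[OF this] bound show ?thesis by auto
qed

section \<open>Mean-field flow\<close>

lemma abs_integral_diff_le:
  fixes g h :: "_ \<Rightarrow> real"
  assumes "prob_space N" and [measurable]: "g \<in> borel_measurable N" "h \<in> borel_measurable N"
    and "\<And>x. \<bar>g x\<bar> \<le> c" "\<And>x. \<bar>h x\<bar> \<le> c" and "AE x in N. \<bar>g x - h x\<bar> \<le> r"
  shows "\<bar>(\<integral>x. g x \<partial>N) - (\<integral>x. h x \<partial>N)\<bar> \<le> r"
proof -
  interpret N: prob_space N by fact
  have int: "integrable N g" "integrable N h"
    using assms by (auto intro!: N.integrable_const_bound[where B = c])
  then have "\<bar>(\<integral>x. g x \<partial>N) - (\<integral>x. h x \<partial>N)\<bar> = \<bar>\<integral>x. g x - h x \<partial>N\<bar>" by simp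
  also have "\<dots> \<le> (\<integral>x. \<bar>g x - h x\<bar> \<partial>N)"
    using integral_norm_bound[of N "\<lambda>x. g x - h x"] by simp
  also have "\<dots> \<le> r" using int assms by (intro N.integral_le_const) auto
  finally show ?thesis .
qed

locale mean_field = prob_space M for M :: "'w measure" +
  fixes a \<kappa> :: "real \<times> real \<Rightarrow> real" and f :: "real \<Rightarrow> real"
    and T A B La Lk Lf :: real
  assumes T_nonneg: "T \<ge> 0"
    and a_bounded: "\<And>p. \<bar>a p\<bar> \<le> A"
    and a_lipschitz: "\<And>x y x' y'. \<bar>a (x, y) - a (x', y')\<bar> \<le> La * (\<bar>x - x'\<bar> + \<bar>y - y'\<bar>)"
    and \<kappa>_bounded: "\<And>p. \<bar>\<kappa> p\<bar> \<le> B"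
    and \<kappa>_lipschitz: "\<And>x y x' y'. \<bar>\<kappa> (x, y) - \<kappa> (x', y')\<bar> \<le> Lk * (\<bar>x - x'\<bar> + \<bar>y - y'\<bar>)"
    and f_lipschitz: "\<And>x y. x \<in> {0..1} \<Longrightarrow> y \<in> {0..1} \<Longrightarrow> \<bar>f x - f y\<bar> \<le> Lf * \<bar>x - y\<bar>"
    and La_pos: "La > 0" and Lk_pos: "Lk > 0" and Lf_nonneg: "Lf \<ge> 0"
begin

abbreviation unif :: "real measure" where
  "unif \<equiv> uniform_measure lborel {0..1}"

definition mean_field_term :: "(real \<Rightarrow> 'w \<Rightarrow> real) \<Rightarrow> real \<Rightarrow> real \<Rightarrow> real" where
  "mean_field_term Z s x = (\<integral>z. \<kappa> (x, z) \<partial>(distr M borel (Z s)))"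

text \<open>Fixing the sample point isolates the exceptional null set. The law of \<open>Z s\<close>
  does not depend on the sample point, so the trajectories of one process solve a single
  deterministic equation with different initial values.\<close>

definition solves_at :: "('w \<Rightarrow> real) \<Rightarrow> (real \<Rightarrow> 'w \<Rightarrow> real) \<Rightarrow> 'w \<Rightarrow> bool" where
  "solves_at V Z \<omega> \<longleftrightarrow> (\<forall>t\<in>{0..T}.
     ((\<lambda>s. a (Z s \<omega>, mean_field_term Z s (Z s \<omega>))) has_integral (Z t \<omega> - f (V \<omega>))) {0..t})"

definition labelled_solution :: "('w \<Rightarrow> real) \<Rightarrow> (real \<Rightarrow> 'w \<Rightarrow> real) \<Rightarrow> bool" where
  "labelled_solution V Z \<longleftrightarrow>
     V \<in> borel_measurable M \<and> distr M borel V = unif \<and> (\<forall>\<omega>. V \<omega> \<in> {0..1}) \<and>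
     mean_field_solution M a \<kappa> T (\<lambda>\<omega>. f (V \<omega>)) Z"

text \<open>The 1 accounts for the state in the first argument of \<open>a\<close>; the two copies
  of \<open>Lk\<close> account for the two arguments of \<open>\<kappa>\<close>.\<close>

definition rate :: real where "rate = La * (1 + 2 * Lk)"

definition flow_lipschitz :: real where "flow_lipschitz = 2 * exp (2 * rate * T) * Lf"

definition flow_of :: "('w \<Rightarrow> real) \<Rightarrow> (real \<Rightarrow> 'w \<Rightarrow> real) \<Rightarrow> (real \<Rightarrow> real \<Rightarrow> real) \<Rightarrow> bool" where
  "flow_of V Z \<psi> \<longleftrightarrow> (\<forall>s\<in>{0..T}. flow_lipschitz-lipschitz_on UNIV (\<psi> s) \<and>
     (\<forall>\<omega>. solves_at V Z \<omega> \<longrightarrow> \<psi> s (V \<omega>) = Z s \<omega>))"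

lemma rate_pos: "rate > 0"
  using La_pos Lk_pos by (simp add: rate_def)

lemma flow_lipschitz_nonneg: "flow_lipschitz \<ge> 0"
  using Lf_nonneg by (simp add: flow_lipschitz_def)

lemma \<kappa>_measurable[measurable]: "(\<lambda>y. \<kappa> (x, y)) \<in> borel_measurable borel"
proof -
  have "Lk-lipschitz_on UNIV (\<lambda>y. \<kappa> (x, y))"
    using \<kappa>_lipschitz[of x _ x] Lk_pos by (auto intro!: lipschitz_onI simp: dist_real_def)
  then show ?thesis by (intro borel_measurable_continuous_onI lipschitz_on_continuous_on)
qed

lemma prob_space_unif: "prob_space unif"
  by (rule prob_space_uniform_measure) auto

lemma AE_unif: "AE u in unif. u \<in> {0..1}"
  by (subst AE_uniform_measure) auto

lemma labelled_solutionD: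
  assumes "labelled_solution V Z"
  shows "V \<in> borel_measurable M" "distr M borel V = unif" "V \<omega> \<in> {0..1}"
    "s \<in> {0..T} \<Longrightarrow> Z s \<in> borel_measurable M" "AE \<omega> in M. solves_at V Z \<omega>"
  using assms
  by (auto simp: labelled_solution_def mean_field_solution_def solves_at_def mean_field_term_def)

lemma mean_field_term_lipschitz:
  assumes "labelled_solution V Z" "s \<in> {0..T}"
  shows "\<bar>mean_field_term Z s x - mean_field_term Z s x'\<bar> \<le> Lk * \<bar>x - x'\<bar>"
proof -
  have "\<bar>\<kappa> (x, z) - \<kappa> (x', z)\<bar> \<le> Lk * \<bar>x - x'\<bar>" for z
    using \<kappa>_lipschitz[of x z x' z] by simp
  then show ?thesis
    unfolding mean_field_term_def using \<kappa>_bounded labelled_solutionD(4)[OF assms]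
    by (intro abs_integral_diff_le[where c = B] prob_space_distr AE_I2) (auto simp: measurable_distr_eq1)
qed

text \<open>The form shared by all three stability arguments: E bounds the unknown differences, and
  r is the residual. It is 0 for one process at two sample points, of order epsilon for nearby
  labels, and the quadrature error for the particles.\<close>

lemma coefficient_diff_le:
  assumes "\<bar>x - x'\<bar> \<le> E" "\<bar>y - y'\<bar> \<le> 2 * Lk * E + r"
  shows "\<bar>a (x, y) - a (x', y')\<bar> \<le> rate * E + La * r"
proof -
  have "\<bar>a (x, y) - a (x', y')\<bar> \<le> La * (\<bar>x - x'\<bar> + \<bar>y - y'\<bar>)" by (rule a_lipschitz)
  also have "\<dots> \<le> La * (E + (2 * Lk * E + r))" using assms La_pos by (intro mult_left_mono) auto
  finally show ?thesis by (simp add: rate_def algebra_simps)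
qed

lemma coefficient_diff_bounded: "\<bar>a p - a q\<bar> \<le> 2 * A"
  using a_bounded[of p] a_bounded[of q] by linarith

text \<open>Two trajectories of the same process see the same mean-field term as a function of the
  state, so only their initial values differ. Stability for a one-element index set bounds their
  distance by that of the labels, and \<open>lipschitz_factorization\<close> supplies the
  flow.\<close>

lemma flow_exists:
  assumes "labelled_solution V Z"
  obtains \<psi> where "flow_of V Z \<psi>"
proof -
  note sol = labelled_solutionD[OF assms]
  have lip: "\<bar>Z s p - Z s q\<bar> \<le> flow_lipschitz * \<bar>V p - V q\<bar>"
    if s: "s \<in> {0..T}" and pq: "solves_at V Z p" "solves_at V Z q" for s p q
  proof -
    have "\<bar>Z s p - Z s q\<bar> \<le> 2 * exp (2 * rate * T) * (Lf * \<bar>V p - V q\<bar> + 0 * T)"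
    proof (rule integral_equation_stability[where J = "UNIV :: unit set" and j = "()"
          and x = "\<lambda>_ s. Z s p" and y = "\<lambda>_ s. Z s q" and T = T and t = s
          and F = "\<lambda>_ s. a (Z s p, mean_field_term Z s (Z s p))"
          and G = "\<lambda>_ s. a (Z s q, mean_field_term Z s (Z s q))"
          and ?x0.0 = "\<lambda>_. f (V p)" and ?y0.0 = "\<lambda>_. f (V q)" and B = "2 * A"])
      fix s E assume s: "s \<in> {0..T}" and E: "\<forall>k\<in>(UNIV::unit set). \<bar>Z s p - Z s q\<bar> \<le> E"
      have "Lk * \<bar>Z s p - Z s q\<bar> \<le> 2 * Lk * E"
        using E Lk_pos by (intro mult_mono[of Lk "2 * Lk"]) auto
      with mean_field_term_lipschitz[OF assms s, of "Z s p" "Z s q"]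
      have "\<bar>mean_field_term Z s (Z s p) - mean_field_term Z s (Z s q)\<bar> \<le> 2 * Lk * E + 0" by simp
      then show "\<bar>a (Z s p, mean_field_term Z s (Z s p)) - a (Z s q, mean_field_term Z s (Z s q))\<bar>
          \<le> rate * E + 0"
        using coefficient_diff_le[of "Z s p" "Z s q" E _ _ 0] E by auto
    qed (use pq s rate_pos f_lipschitz[OF sol(3) sol(3)] coefficient_diff_bounded in \<open>auto simp: solves_at_def\<close>)
    then show ?thesis by (simp add: flow_lipschitz_def mult_ac)
  qed
  have "\<exists>\<psi>. flow_lipschitz-lipschitz_on UNIV \<psi> \<and> (\<forall>\<omega>. solves_at V Z \<omega> \<longrightarrow> \<psi> (V \<omega>) = Z s \<omega>)"
    if "s \<in> {0..T}" for s
    using lipschitz_factorization[of "Collect (solves_at V Z)" "Z s" flow_lipschitz V]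
      lip[OF that] flow_lipschitz_nonneg by (metis mem_Collect_eq)
  then show ?thesis using that unfolding flow_of_def by metis
qed

lemma flow_ofD:
  assumes "flow_of V Z \<psi>" "s \<in> {0..T}"
  shows "flow_lipschitz-lipschitz_on UNIV (\<psi> s)"
    "solves_at V Z \<omega> \<Longrightarrow> \<psi> s (V \<omega>) = Z s \<omega>"
    "\<psi> s \<in> borel_measurable borel"
    "\<bar>\<psi> s u - \<psi> s v\<bar> \<le> flow_lipschitz * \<bar>u - v\<bar>"
proof -
  show *: "flow_lipschitz-lipschitz_on UNIV (\<psi> s)" using assms by (simp add: flow_of_def)
  then show "\<psi> s \<in> borel_measurable borel"
    by (intro borel_measurable_continuous_onI lipschitz_on_continuous_on)
  show "\<bar>\<psi> s u - \<psi> s v\<bar> \<le> flow_lipschitz * \<bar>u - v\<bar>"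
    using lipschitz_onD[OF *] by (simp add: dist_real_def)
  show "solves_at V Z \<omega> \<Longrightarrow> \<psi> s (V \<omega>) = Z s \<omega>" using assms by (simp add: flow_of_def)
qed

text \<open>Almost surely \<open>Z s\<close> is the flow evaluated at the uniform label, so its law
  is the image of the uniform law. This turns the mean-field term into an integral over labels,
  where different solutions become comparable.\<close>

lemma mean_field_term_flow:
  assumes sol: "labelled_solution V Z" and flow: "flow_of V Z \<psi>" and s: "s \<in> {0..T}"
  shows "mean_field_term Z s x = (\<integral>u. \<kappa> (x, \<psi> s u) \<partial>unif)"
proof -
  note [measurable] = labelled_solutionD(1)[OF sol] labelled_solutionD(4)[OF sol s] flow_ofD(3)[OF flow s]
  have "mean_field_term Z s x = (\<integral>\<omega>. \<kappa> (x, Z s \<omega>) \<partial>M)"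
    unfolding mean_field_term_def by (subst integral_distr) auto
  also have "\<dots> = (\<integral>\<omega>. \<kappa> (x, \<psi> s (V \<omega>)) \<partial>M)"
  proof (rule integral_cong_AE)
    show "AE \<omega> in M. \<kappa> (x, Z s \<omega>) = \<kappa> (x, \<psi> s (V \<omega>))"
      using labelled_solutionD(5)[OF sol] by eventually_elim (simp add: flow_ofD(2)[OF flow s])
  qed measurable
  also have "\<dots> = (\<integral>u. \<kappa> (x, \<psi> s u) \<partial>distr M borel V)"
    by (subst integral_distr) auto
  finally show ?thesis by (simp add: labelled_solutionD(2)[OF sol])
qed

text \<open>An interval of positive length in [0, 1] has positive probability under the uniform law,
  so labels from an almost sure event cannot avoid it.\<close>

lemma solving_label_dense:
  assumes sol: "labelled_solution V Z" and u: "u \<in> {0..1}" and "\<epsilon> > 0"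
  obtains \<omega> where "solves_at V Z \<omega>" "\<bar>V \<omega> - u\<bar> \<le> \<epsilon>"
proof (rule ccontr)
  assume none: "\<not> thesis"
  note [measurable] = labelled_solutionD(1)[OF sol]
  define l r where "l = max 0 (u - \<epsilon>)" and "r = min 1 (u + \<epsilon>)"
  have lr: "l < r" using u \<open>\<epsilon> > 0\<close> by (auto simp: l_def r_def)
  have "AE \<omega> in M. V \<omega> \<notin> {l..r}"
    using labelled_solutionD(5)[OF sol]
  proof eventually_elim
    case (elim \<omega>)
    then have "\<not> \<bar>V \<omega> - u\<bar> \<le> \<epsilon>" using none that by blast
    then show ?case by (auto simp: l_def r_def)
  qed
  then have "AE v in distr M borel V. v \<notin> {l..r}" by (subst AE_distr_iff) auto
  then have "AE v in lborel. v \<in> {0..1} \<longrightarrow> v \<notin> {l..r}"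
    unfolding labelled_solutionD(2)[OF sol] by (subst (asm) AE_uniform_measure) auto
  then have "AE v in lborel. v \<notin> {l..r}"
    by eventually_elim (auto simp: l_def r_def)
  then have "{l..r} \<in> null_sets lborel" by (subst AE_iff_null_sets) auto
  then show False using lr by (auto simp: null_sets_def)
qed

text \<open>The mean-field term depends on the whole law, so all labels have to be compared at once.
  Pairs of solving sample points with labels at distance at most 2 epsilon suffice, since such
  labels are dense and both flows are Lipschitz; then epsilon tends to 0.\<close>

lemma flow_unique:
  assumes sol: "labelled_solution V Z" "labelled_solution V' Z'"
    and flow: "flow_of V Z \<psi>" "flow_of V' Z' \<psi>'"
    and t: "t \<in> {0..T}" and u: "u \<in> {0..1}"
  shows "\<psi> t u = \<psi>' t u"
proof -
  \<comment> \<open>The stability bound has initial error 2 Lf epsilon and residual 2 La Lk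
    \<open>flow_lipschitz\<close> epsilon; the last summand pays for moving from u to the two labels
    near it.\<close>
  define c where "c = 2 * exp (2 * rate * T) * (2 * Lf + 2 * La * Lk * flow_lipschitz * T) + 2 * flow_lipschitz"
  have "\<bar>\<psi> t u - \<psi>' t u\<bar> \<le> c * \<epsilon>" if "\<epsilon> > 0" for \<epsilon>
  proof -
    define J where "J = {(p, q). solves_at V Z p \<and> solves_at V' Z' q \<and> \<bar>V p - V' q\<bar> \<le> 2 * \<epsilon>}"
    have ex_pair: "\<exists>p q. (p, q) \<in> J \<and> (\<forall>s\<in>{0..T}. \<bar>\<psi> s u - \<psi>' s u\<bar> \<le> \<bar>Z s p - Z' s q\<bar> + 2 * flow_lipschitz * \<epsilon>)"
      if u: "u \<in> {0..1}" for u
    proof -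
      obtain p where p: "solves_at V Z p" "\<bar>V p - u\<bar> \<le> \<epsilon>"
        using solving_label_dense[OF sol(1) u \<open>\<epsilon> > 0\<close>] by blast
      obtain q where q: "solves_at V' Z' q" "\<bar>V' q - u\<bar> \<le> \<epsilon>"
        using solving_label_dense[OF sol(2) u \<open>\<epsilon> > 0\<close>] by blast
      have "\<bar>\<psi> s u - \<psi>' s u\<bar> \<le> \<bar>Z s p - Z' s q\<bar> + 2 * flow_lipschitz * \<epsilon>" if s: "s \<in> {0..T}" for s
      proof -
        have "\<bar>\<psi> s (V p) - \<psi> s u\<bar> \<le> flow_lipschitz * \<epsilon>"
          using flow_ofD(4)[OF flow(1) s, of "V p" u] mult_left_mono[OF p(2) flow_lipschitz_nonneg] by linarith
        moreover have "\<bar>\<psi>' s (V' q) - \<psi>' s u\<bar> \<le> flow_lipschitz * \<epsilon>"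
          using flow_ofD(4)[OF flow(2) s, of "V' q" u] mult_left_mono[OF q(2) flow_lipschitz_nonneg] by linarith
        ultimately show ?thesis
          using flow_ofD(2)[OF flow(1) s p(1)] flow_ofD(2)[OF flow(2) s q(1)] by linarith
      qed
      moreover have "(p, q) \<in> J" using p q by (auto simp: J_def)
      ultimately show ?thesis by blast
    qed
    have pair_le: "\<bar>Z t (fst j) - Z' t (snd j)\<bar>
        \<le> 2 * exp (2 * rate * T) * (Lf * (2 * \<epsilon>) + (La * (Lk * (2 * flow_lipschitz * \<epsilon>))) * T)"
      if j: "j \<in> J" for j
    proof (rule integral_equation_stability[where J = J and j = j and T = T and t = t
          and x = "\<lambda>j s. Z s (fst j)" and y = "\<lambda>j s. Z' s (snd j)"
          and F = "\<lambda>j s. a (Z s (fst j), mean_field_term Z s (Z s (fst j)))"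
          and G = "\<lambda>j s. a (Z' s (snd j), mean_field_term Z' s (Z' s (snd j)))"
          and ?x0.0 = "\<lambda>j. f (V (fst j))" and ?y0.0 = "\<lambda>j. f (V' (snd j))" and B = "2 * A"])
      fix j assume "j \<in> J"
      then have "Lf * \<bar>V (fst j) - V' (snd j)\<bar> \<le> Lf * (2 * \<epsilon>)"
        using Lf_nonneg by (intro mult_left_mono) (auto simp: J_def)
      with f_lipschitz[OF labelled_solutionD(3)[OF sol(1)] labelled_solutionD(3)[OF sol(2)]]
      show "\<bar>f (V (fst j)) - f (V' (snd j))\<bar> \<le> Lf * (2 * \<epsilon>)" by (rule order.trans)
    next
      fix j s E assume j: "j \<in> J" and s: "s \<in> {0..T}" and E: "\<forall>k\<in>J. \<bar>Z s (fst k) - Z' s (snd k)\<bar> \<le> E"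
      let ?z = "Z s (fst j)" and ?z' = "Z' s (snd j)"
      \<comment> \<open>A bound E over all pairs in \<open>J\<close> controls the two flows at every
        label, which closes the estimate although \<open>J\<close> holds only pairs of sample
        points.\<close>
      have \<psi>_close: "\<bar>\<psi> s u - \<psi>' s u\<bar> \<le> E + 2 * flow_lipschitz * \<epsilon>" if "u \<in> {0..1}" for u
        using ex_pair[OF that] E s by force
      note [measurable] = flow_ofD(3)[OF flow(1) s] flow_ofD(3)[OF flow(2) s]
      \<comment> \<open>First the law is changed at the fixed state \<open>?z'\<close>, then the
        state is changed under the fixed law.\<close>
      have "\<bar>mean_field_term Z s ?z' - mean_field_term Z' s ?z'\<bar> \<le> Lk * (E + 2 * flow_lipschitz * \<epsilon>)"
        unfolding mean_field_term_flow[OF sol(1) flow(1) s] mean_field_term_flow[OF sol(2) flow(2) s]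
      proof (rule abs_integral_diff_le[OF prob_space_unif, where c = B])
        show "AE u in unif. \<bar>\<kappa> (?z', \<psi> s u) - \<kappa> (?z', \<psi>' s u)\<bar> \<le> Lk * (E + 2 * flow_lipschitz * \<epsilon>)"
          using AE_unif
        proof eventually_elim
          case (elim u)
          have "\<bar>\<kappa> (?z', \<psi> s u) - \<kappa> (?z', \<psi>' s u)\<bar> \<le> Lk * \<bar>\<psi> s u - \<psi>' s u\<bar>"
            using \<kappa>_lipschitz[of ?z' "\<psi> s u" ?z' "\<psi>' s u"] by simp
          also have "\<dots> \<le> Lk * (E + 2 * flow_lipschitz * \<epsilon>)"
            using \<psi>_close[OF elim] Lk_pos by (intro mult_left_mono) auto
          finally show ?case .
        qed
      qed (use \<kappa>_bounded in auto)
      moreover have zE: "\<bar>?z - ?z'\<bar> \<le> E" using E j by auto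
      then have "Lk * \<bar>?z - ?z'\<bar> \<le> Lk * E" using Lk_pos by (intro mult_left_mono) auto
      with mean_field_term_lipschitz[OF sol(1) s, of ?z ?z']
      have "\<bar>mean_field_term Z s ?z - mean_field_term Z s ?z'\<bar> \<le> Lk * E" by linarith
      ultimately have "\<bar>mean_field_term Z s ?z - mean_field_term Z' s ?z'\<bar>
          \<le> 2 * Lk * E + Lk * (2 * flow_lipschitz * \<epsilon>)"
        unfolding distrib_left by linarith
      with zE show "\<bar>a (?z, mean_field_term Z s ?z) - a (?z', mean_field_term Z' s ?z')\<bar>
          \<le> rate * E + La * (Lk * (2 * flow_lipschitz * \<epsilon>))"
        by (rule coefficient_diff_le)
    next
      show "0 \<le> La * (Lk * (2 * flow_lipschitz * \<epsilon>))"
        using La_pos Lk_pos flow_lipschitz_nonneg \<open>\<epsilon> > 0\<close> by simp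
    qed (use j t rate_pos coefficient_diff_bounded in \<open>auto simp: J_def solves_at_def\<close>)
    obtain p q where pq: "(p, q) \<in> J" "\<bar>\<psi> t u - \<psi>' t u\<bar> \<le> \<bar>Z t p - Z' t q\<bar> + 2 * flow_lipschitz * \<epsilon>"
      using ex_pair[OF u] t by blast
    then show ?thesis using pair_le[OF pq(1)] by (simp add: c_def algebra_simps)
  qed
  note le = this
  have "\<bar>\<psi> t u - \<psi>' t u\<bar> \<le> 0"
  proof (rule field_le_epsilon)
    fix e :: real assume "e > 0"
    have "c \<ge> 0" using Lf_nonneg La_pos Lk_pos flow_lipschitz_nonneg T_nonneg by (simp add: c_def)
    \<comment> \<open>Dividing by c + 1 keeps the choice of epsilon valid when c = 0.\<close>
    have "c * (e / (c + 1)) \<le> e" using \<open>c \<ge> 0\<close> \<open>e > 0\<close> by (simp add: field_simps)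
    with le[of "e / (c + 1)"] show "\<bar>\<psi> t u - \<psi>' t u\<bar> \<le> 0 + e" using \<open>c \<ge> 0\<close> \<open>e > 0\<close> by simp
  qed
  then show ?thesis by simp
qed

section \<open>Distance between particles and mean-field solutions\<close>

definition particle_error :: real where
  "particle_error = 2 * exp (2 * rate * T) * (La * (Lk * flow_lipschitz)) * T"

lemma particle_error_nonneg: "particle_error \<ge> 0"
  using La_pos Lk_pos flow_lipschitz_nonneg T_nonneg by (simp add: particle_error_def)

text \<open>At a fixed sample point all the \<open>Z i\<close> are values of one flow at the labels
  \<open>V i\<close>, so their empirical mean differs from the mean-field term by a quadrature
  error. The initial values coincide, and this error is the only source term in the stability
  estimate.\<close>

lemma particle_error_bound:
  fixes X :: "nat \<Rightarrow> real \<Rightarrow> real" and Y :: "nat \<Rightarrow> real \<Rightarrow> 'w \<Rightarrow> real" and V :: "nat \<Rightarrow> 'w \<Rightarrow> real"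
  assumes P: "P \<ge> 1"
    and ref: "labelled_solution V0 Z0"
    and sol: "\<And>i. i \<in> {1..P} \<Longrightarrow> labelled_solution (V i) (Z i)"
    and solves: "\<And>i. i \<in> {1..P} \<Longrightarrow> solves_at (V i) (Z i) \<omega>"
    and X: "\<And>i t. i \<in> {1..P} \<Longrightarrow> t \<in> {0..T} \<Longrightarrow>
       ((\<lambda>s. a (X i s, (1 / real P) * (\<Sum>j=1..P. \<kappa> (X i s, X j s)))) has_integral (X i t - f (V i \<omega>))) {0..t}"
    and i: "i \<in> {1..P}" and t: "t \<in> {0..T}"
  shows "\<bar>X i t - Z i t \<omega>\<bar> \<le> particle_error * star_discrepancy P (\<lambda>i. V i \<omega>)"
proof -
  let ?D = "star_discrepancy P (\<lambda>i. V i \<omega>)"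
  obtain \<psi> where \<psi>: "flow_of V0 Z0 \<psi>" using flow_exists[OF ref] .
  have "\<forall>i\<in>{1..P}. \<exists>\<psi>. flow_of (V i) (Z i) \<psi>" using flow_exists[OF sol] by blast
  then obtain \<phi> where \<phi>: "\<And>i. i \<in> {1..P} \<Longrightarrow> flow_of (V i) (Z i) (\<phi> i)" by metis
  \<comment> \<open>Each solution comes with its own flow; on [0, 1] all of them equal the flow of
    the reference solution.\<close>
  have \<phi>_eq: "\<phi> i s u = \<psi> s u" if "i \<in> {1..P}" "s \<in> {0..T}" "u \<in> {0..1}" for i s u
    using flow_unique[OF sol[OF that(1)] ref \<phi>[OF that(1)] \<psi> that(2,3)] .
  have "\<bar>X i t - Z i t \<omega>\<bar> \<le> 2 * exp (2 * rate * T) * (0 + (La * (Lk * flow_lipschitz * ?D)) * T)"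
  proof (rule integral_equation_stability[where J = "{1..P}" and j = i and T = T and t = t
        and x = X and y = "\<lambda>i s. Z i s \<omega>"
        and F = "\<lambda>i s. a (X i s, (1 / real P) * (\<Sum>j=1..P. \<kappa> (X i s, X j s)))"
        and G = "\<lambda>i s. a (Z i s \<omega>, mean_field_term (Z i) s (Z i s \<omega>))"
        and ?x0.0 = "\<lambda>i. f (V i \<omega>)" and ?y0.0 = "\<lambda>i. f (V i \<omega>)" and B = "2 * A"])
    fix i s E assume i: "i \<in> {1..P}" and s: "s \<in> {0..T}"
      and E: "\<forall>k\<in>{1..P}. \<bar>X k s - Z k s \<omega>\<bar> \<le> E"
    let ?z = "Z i s \<omega>"
    have Z_eq: "Z j s \<omega> = \<psi> s (V j \<omega>)" if "j \<in> {1..P}" for j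
      using flow_ofD(2)[OF \<phi>[OF that] s solves[OF that]]
        \<phi>_eq[OF that s labelled_solutionD(3)[OF sol[OF that]]] by simp
    note [measurable] = flow_ofD(3)[OF \<psi> s] flow_ofD(3)[OF \<phi>[OF i] s]
    have "mean_field_term (Z i) s ?z = (\<integral>u. \<kappa> (?z, \<phi> i s u) \<partial>unif)"
      by (rule mean_field_term_flow[OF sol[OF i] \<phi>[OF i] s])
    also have "\<dots> = (\<integral>u. \<kappa> (?z, \<psi> s u) \<partial>unif)"
    proof (rule integral_cong_AE)
      show "AE u in unif. \<kappa> (?z, \<phi> i s u) = \<kappa> (?z, \<psi> s u)"
        using AE_unif by eventually_elim (simp add: \<phi>_eq[OF i s])
    qed measurable
    finally have mf_eq: "mean_field_term (Z i) s ?z = (\<integral>u. \<kappa> (?z, \<psi> s u) \<partial>unif)" .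
    have "(Lk * flow_lipschitz)-lipschitz_on UNIV (\<lambda>u. \<kappa> (?z, \<psi> s u))"
    proof (rule lipschitz_onI)
      fix u v
      have "\<bar>\<kappa> (?z, \<psi> s u) - \<kappa> (?z, \<psi> s v)\<bar> \<le> Lk * \<bar>\<psi> s u - \<psi> s v\<bar>"
        using \<kappa>_lipschitz[of ?z "\<psi> s u" ?z "\<psi> s v"] by simp
      also have "\<dots> \<le> Lk * (flow_lipschitz * \<bar>u - v\<bar>)"
        using flow_ofD(4)[OF \<psi> s] Lk_pos by (intro mult_left_mono) auto
      finally show "dist (\<kappa> (?z, \<psi> s u)) (\<kappa> (?z, \<psi> s v)) \<le> Lk * flow_lipschitz * dist u v"
        by (simp add: dist_real_def mult_ac)
    qed (use Lk_pos flow_lipschitz_nonneg in simp)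
    from koksma_lipschitz[OF this P, of "\<lambda>j. V j \<omega>"]
    have 1: "\<bar>(1 / real P) * (\<Sum>j=1..P. \<kappa> (?z, Z j s \<omega>)) - mean_field_term (Z i) s ?z\<bar>
        \<le> Lk * flow_lipschitz * ?D"
      using labelled_solutionD(3)[OF sol] by (simp add: mf_eq Z_eq cong: sum.cong_simp)
    \<comment> \<open>Both arguments of \<open>\<kappa>\<close> move by at most E, which is where
      the factor 2 in \<open>rate\<close> comes from.\<close>
    have "\<bar>\<Sum>j=1..P. \<kappa> (X i s, X j s) - \<kappa> (?z, Z j s \<omega>)\<bar> \<le> (\<Sum>j=1..P. 2 * Lk * E)"
    proof (rule order.trans[OF sum_abs sum_mono])
      fix j assume j: "j \<in> {1..P}"
      have "Lk * (\<bar>X i s - ?z\<bar> + \<bar>X j s - Z j s \<omega>\<bar>) \<le> Lk * (E + E)"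
        using E i j Lk_pos by (intro mult_left_mono add_mono) auto
      with \<kappa>_lipschitz[of "X i s" "X j s" ?z "Z j s \<omega>"]
      show "\<bar>\<kappa> (X i s, X j s) - \<kappa> (?z, Z j s \<omega>)\<bar> \<le> 2 * Lk * E" by (simp add: algebra_simps)
    qed
    then have "\<bar>(\<Sum>j=1..P. \<kappa> (X i s, X j s)) - (\<Sum>j=1..P. \<kappa> (?z, Z j s \<omega>))\<bar> / real P \<le> 2 * Lk * E"
      using P by (simp add: sum_subtractf pos_divide_le_eq mult.commute)
    then have 2: "\<bar>(1 / real P) * (\<Sum>j=1..P. \<kappa> (X i s, X j s)) - (1 / real P) * (\<Sum>j=1..P. \<kappa> (?z, Z j s \<omega>))\<bar> \<le> 2 * Lk * E"
      by (simp add: abs_divide flip: diff_divide_distrib)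
    have "\<bar>(1 / real P) * (\<Sum>j=1..P. \<kappa> (X i s, X j s)) - mean_field_term (Z i) s ?z\<bar>
        \<le> 2 * Lk * E + Lk * flow_lipschitz * ?D"
      using 1 2 by linarith
    then show "\<bar>a (X i s, (1 / real P) * (\<Sum>j=1..P. \<kappa> (X i s, X j s))) - a (?z, mean_field_term (Z i) s ?z)\<bar>
        \<le> rate * E + La * (Lk * flow_lipschitz * ?D)"
      using E i by (intro coefficient_diff_le) auto
  next
    show "0 \<le> La * (Lk * flow_lipschitz * ?D)"
      using La_pos Lk_pos flow_lipschitz_nonneg star_discrepancy_nonneg[of P] by simp
  qed (use X solves i t rate_pos coefficient_diff_bounded in \<open>auto simp: solves_at_def\<close>)
  then show ?thesis by (simp add: particle_error_def mult_ac)
qed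

end

section \<open>Mean-square error of the observables\<close>

theorem theorem3:
  fixes M :: "'w measure" and U :: "'w \<Rightarrow> real"
    and T C :: real
    and a \<kappa> :: "real \<times> real \<Rightarrow> real"
    and f :: "real \<Rightarrow> real"
    and \<zeta> :: "nat \<Rightarrow> nat \<Rightarrow> real"
    and X Z :: "nat \<Rightarrow> nat \<Rightarrow> real \<Rightarrow> 'w \<Rightarrow> real"
    and g :: "nat \<Rightarrow> (nat \<Rightarrow> real) \<Rightarrow> real"
  assumes "prob_space M"
    and "U \<in> borel_measurable M"
    and "distr M borel U = uniform_measure lborel {0..1}"
    and "T > 0"
    and "Cb 2 a"
    and "Cb 1 \<kappa>"
    and "f C1_differentiable_on UNIV"
    and "\<And>x. f (x + 1) = f x"
    and "\<And>P i. P \<ge> 1 \<Longrightarrow> i \<in> {1..P} \<Longrightarrow> \<zeta> P i \<in> {0..1}"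
    and "\<And>P. P \<ge> 1 \<Longrightarrow>
           particle_solution M a \<kappa> T P (\<lambda>i \<omega>. f (frac (\<zeta> P i + U \<omega>))) (X P)"
    and "\<And>P i. P \<ge> 1 \<Longrightarrow> i \<in> {1..P} \<Longrightarrow>
           mean_field_solution M a \<kappa> T (\<lambda>\<omega>. f (frac (\<zeta> P i + U \<omega>))) (Z P i)"
    and "\<And>P. P \<ge> 1 \<Longrightarrow> bounded (g P ` Rspace P)"
    and "\<And>P. P \<ge> 1 \<Longrightarrow> Cn 2 P (g P)"
    and "C > 0"
    and "\<And>P. P \<ge> 1 \<Longrightarrow>
           (\<Sum>k\<in>multi_indices P 2. Linf_norm P (multi_deriv P k (g P))) \<le> ennreal C"
  shows "\<exists>K. \<forall>P\<ge>1.
           prob_space.expectation M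
             (\<lambda>\<omega>. (g P (\<lambda>i\<in>{1..P}. X P i T \<omega>) - g P (\<lambda>i\<in>{1..P}. Z P i T \<omega>))\<^sup>2)
           \<le> K * (SUP x\<in>{0..1}. (star_discrepancy P (\<lambda>i. frac (\<zeta> P i + x)))\<^sup>2)"
proof -
  note M = assms(1) and U = assms(2,3) and \<zeta> = assms(9) and X = assms(10) and Z = assms(11)
  interpret prob_space M by (rule M)
  obtain A where A: "\<And>p. \<bar>a p\<bar> \<le> A" using Cb_bounded[OF assms(5)] by metis
  obtain B where B: "\<And>p. \<bar>\<kappa> p\<bar> \<le> B" using Cb_bounded[OF assms(6)] by metis
  obtain La where La: "La > 0" "\<And>x y x' y'. \<bar>a (x, y) - a (x', y')\<bar> \<le> La * (\<bar>x - x'\<bar> + \<bar>y - y'\<bar>)"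
    using Cb_Suc_lipschitz[of 1 a] assms(5) by (metis Suc_1)
  obtain Lk where Lk: "Lk > 0" "\<And>x y x' y'. \<bar>\<kappa> (x, y) - \<kappa> (x', y')\<bar> \<le> Lk * (\<bar>x - x'\<bar> + \<bar>y - y'\<bar>)"
    using Cb_Suc_lipschitz[of 0 \<kappa>] assms(6) by (metis One_nat_def)
  obtain Lf where Lf: "Lf \<ge> 0" "\<And>x y. x \<in> {0..1} \<Longrightarrow> y \<in> {0..1} \<Longrightarrow> \<bar>f x - f y\<bar> \<le> Lf * \<bar>x - y\<bar>"
    using C1_lipschitz_on_Icc[OF assms(7), of 0 1] by metis
  interpret mean_field M a \<kappa> f T A B La Lk Lf
    using A B La Lk Lf \<open>T > 0\<close> by unfold_locales auto
  define V where "V P i \<omega> = frac (\<zeta> P i + U \<omega>)" for P i \<omega>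
  have sol: "labelled_solution (V P i) (Z P i)" if P: "P \<ge> 1" and i: "i \<in> {1..P}" for P i
  proof -
    have "V P i \<in> borel_measurable M" unfolding V_def frac_def using U(1) by measurable
    moreover have "distr M borel (V P i) = unif"
      unfolding V_def by (rule frac_shift_uniform[OF M U \<zeta>[OF P i]])
    moreover have "V P i \<omega> \<in> {0..1}" for \<omega>
      using frac_ge_0[of "\<zeta> P i + U \<omega>"] frac_lt_1[of "\<zeta> P i + U \<omega>"] by (simp add: V_def)
    ultimately show ?thesis
      using Z[OF P i] by (simp add: labelled_solution_def V_def[abs_def])
  qed
  \<comment> \<open>This makes the random discrepancy almost surely one of the values under the
    supremum over x.\<close>
  have AE_U: "AE \<omega> in M. U \<omega> \<in> {0..1}"
  proof -
    have "AE u in distr M borel U. u \<in> {0..1}" unfolding U(2) by (rule AE_unif)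
    then show ?thesis using U(1) by (subst (asm) AE_distr_iff) auto
  qed
  let ?S = "\<lambda>P. SUP x\<in>{0..1}. (star_discrepancy P (\<lambda>i. frac (\<zeta> P i + x)))\<^sup>2"
  have S_upper: "(star_discrepancy P (\<lambda>i. frac (\<zeta> P i + x)))\<^sup>2 \<le> ?S P" if "x \<in> {0..1}" for P x
  proof (rule cSUP_upper[OF that])
    show "bdd_above ((\<lambda>x. (star_discrepancy P (\<lambda>i. frac (\<zeta> P i + x)))\<^sup>2) ` {0..1})"
      by (rule bdd_aboveI2[where M = 1])
        (use star_discrepancy_nonneg star_discrepancy_le_1 in \<open>simp add: power_le_one\<close>)
  qed
  have "expectation (\<lambda>\<omega>. (g P (\<lambda>i\<in>{1..P}. X P i T \<omega>) - g P (\<lambda>i\<in>{1..P}. Z P i T \<omega>))\<^sup>2)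
      \<le> (C * particle_error)\<^sup>2 * ?S P" (is "expectation ?h \<le> _") if P: "P \<ge> 1" for P
  proof -
    have AE_le: "AE \<omega> in M. ?h \<omega> \<le> (C * particle_error)\<^sup>2 * ?S P"
    proof -
      have "AE \<omega> in M. \<forall>i\<in>{1..P}. solves_at (V P i) (Z P i) \<omega>"
        using labelled_solutionD(5)[OF sol[OF P]] by (intro AE_finite_allI) auto
      moreover have "AE \<omega> in M. \<forall>i\<in>{1..P}. \<forall>t\<in>{0..T}.
          ((\<lambda>s. a (X P i s \<omega>, (1 / real P) * (\<Sum>j=1..P. \<kappa> (X P i s \<omega>, X P j s \<omega>))))
            has_integral (X P i t \<omega> - f (V P i \<omega>))) {0..t}"
        using X[OF P] by (simp add: particle_solution_def V_def)
      ultimately show ?thesis using AE_U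
      proof eventually_elim
        case (elim \<omega>)
        let ?D = "star_discrepancy P (\<lambda>i. V P i \<omega>)"
        have D: "0 \<le> ?D" by (rule star_discrepancy_nonneg)
        \<comment> \<open>The reference solution is the one for P = 1 and i = 1; by uniqueness of
          the flow the choice is immaterial.\<close>
        have X_Z: "\<bar>X P i T \<omega> - Z P i T \<omega>\<bar> \<le> particle_error * ?D" if "i \<in> {1..P}" for i
          using particle_error_bound[where V = "V P" and Z = "Z P" and X = "\<lambda>i s. X P i s \<omega>" and \<omega> = \<omega>,
              OF P sol[of 1 1] sol[OF P] _ _ that] elim \<open>T > 0\<close>
          by auto
        have Cn: "Cn (Suc 1) P (g P)" using assms(13)[OF P] by (simp only: Suc_1)
        have "\<bar>g P (\<lambda>i\<in>{1..P}. X P i T \<omega>) - g P (\<lambda>i\<in>{1..P}. Z P i T \<omega>)\<bar>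
            \<le> C * (particle_error * ?D)"
          using X_Z \<open>C > 0\<close> particle_error_nonneg D
          by (intro lipschitz_of_Linf_bound[OF Cn _ assms(15)[OF P]]) auto
        then have "?h \<omega> \<le> (C * (particle_error * ?D))\<^sup>2"
          by (intro abs_le_square_iff[THEN iffD1]) linarith
        also have "\<dots> = (C * particle_error)\<^sup>2 * ?D\<^sup>2" by (simp add: power_mult_distrib)
        also have "\<dots> \<le> (C * particle_error)\<^sup>2 * ?S P"
          using S_upper[of "U \<omega>" P] elim(3) by (intro mult_left_mono) (auto simp: V_def)
        finally show ?case .
      qed
    qed
    \<comment> \<open>The Bochner integral of a non-integrable function is 0, so in that case the
      bound reduces to nonnegativity of the right-hand side.\<close>
    show ?thesis
    proof (cases "integrable M ?h")
      case True
      then show ?thesis using AE_le by (rule integral_le_const)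
    next
      case False
      have "0 \<le> ?S P" using S_upper[of 0 P] by (rule order.trans[OF zero_le_power2]) simp
      then show ?thesis
        unfolding not_integrable_integral_eq[OF False] by (intro mult_nonneg_nonneg) simp_all
    qed
  qed
  then show ?thesis by blast
qed

end
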